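(* Let $\Omega\subset\mathbb C$ be a simply connected domain. Then the automorphism group $\operatorname{Aut}(H(\Omega))$ is topologically reflexive if and only if $\Omega\neq\mathbb C$.
   Context: A domain is a (nonempty) open connected subset of $\mathbb C$. $H(\Omega)$ is the Fréchet algebra of all holomorphic functions $\Omega\to\mathbb C$ with the topology of uniform convergence on compact subsets of $\Omega$. For a topological algebra $\mathscr A$: $\operatorname{Aut}(\mathscr A)$ is the group of all continuous (linear) algebra automorphisms of $\mathscr A$; $B(\mathscr A)$ is the algebra of all continuous linear operators on $\mathscr A$. For $\mathscr S\subset B(\mathscr A)$ put $\operatorname{ref}_{to}\mathscr S=\{T\in B(\mathscr A): Tx\in\overline{\{Lx:L\in\mathscr S\}}\text{ for all }x\in\mathscr A\}$ (closure in $\mathscr A$); $\mathscr S$ is topologically reflexive if $\operatorname{ref}_{to}\mathscr S=\mathscr S$. *)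

theory Defs
  imports "HOL-Complex_Analysis.Complex_Analysis" "HOL-Library.FuncSet"
begin

text \<open>A holomorphic function on \<open>\<Omega>\<close> is represented by its extension by \<open>0\<close> outside \<open>\<Omega>\<close>: this
  makes the representative unique, and the set closed under the pointwise algebra operations.\<close>

definition hol_funs :: "complex set \<Rightarrow> (complex \<Rightarrow> complex) set" where
  "hol_funs \<Omega> = {f. f holomorphic_on \<Omega> \<and> (\<forall>z. z \<notin> \<Omega> \<longrightarrow> f z = 0)}"

text \<open>Topology of uniform convergence on the compact subsets of \<open>\<Omega>\<close>; the neighbourhoods below form
  a base of the filter at \<open>f\<close>, since finite unions of compact sets are compact.\<close>

definition hol_open :: "complex set \<Rightarrow> (complex \<Rightarrow> complex) set \<Rightarrow> bool" where
  "hol_open \<Omega> U \<longleftrightarrow> U \<subseteq> hol_funs \<Omega> \<and>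
     (\<forall>f\<in>U. \<exists>K e. compact K \<and> K \<subseteq> \<Omega> \<and> 0 < e \<and>
        {g \<in> hol_funs \<Omega>. \<forall>z\<in>K. dist (g z) (f z) < e} \<subseteq> U)"

lemma istopology_hol_open: "istopology (hol_open \<Omega>)"
  unfolding istopology_def
proof (intro conjI allI impI)
  fix U V assume U: "hol_open \<Omega> U" and V: "hol_open \<Omega> V"
  have "\<exists>K e. compact K \<and> K \<subseteq> \<Omega> \<and> 0 < e \<and>
      {g \<in> hol_funs \<Omega>. \<forall>z\<in>K. dist (g z) (f z) < e} \<subseteq> U \<inter> V" if f: "f \<in> U \<inter> V" for f
  proof -
    obtain K d where K: "compact K" "K \<subseteq> \<Omega>" "0 < d"
      "{g \<in> hol_funs \<Omega>. \<forall>z\<in>K. dist (g z) (f z) < d} \<subseteq> U"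
      using U f unfolding hol_open_def by blast
    obtain L e where L: "compact L" "L \<subseteq> \<Omega>" "0 < e"
      "{g \<in> hol_funs \<Omega>. \<forall>z\<in>L. dist (g z) (f z) < e} \<subseteq> V"
      using V f unfolding hol_open_def by blast
    have "{g \<in> hol_funs \<Omega>. \<forall>z\<in>K \<union> L. dist (g z) (f z) < min d e} \<subseteq> U \<inter> V"
      using K(4) L(4) by auto
    moreover have "compact (K \<union> L)" "K \<union> L \<subseteq> \<Omega>" "0 < min d e"
      using K L by auto
    ultimately show ?thesis by blast
  qed
  then show "hol_open \<Omega> (U \<inter> V)"
    using U unfolding hol_open_def by blast
next
  fix \<U> assume *: "\<forall>U\<in>\<U>. hol_open \<Omega> U"
  show "hol_open \<Omega> (\<Union>\<U>)"
    unfolding hol_open_def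
  proof (intro conjI ballI)
    show "\<Union>\<U> \<subseteq> hol_funs \<Omega>" using * unfolding hol_open_def by blast
  next
    fix f assume "f \<in> \<Union>\<U>"
    then obtain U where "U \<in> \<U>" "f \<in> U" by blast
    with * obtain K e where "compact K \<and> K \<subseteq> \<Omega> \<and> 0 < e \<and>
        {g \<in> hol_funs \<Omega>. \<forall>z\<in>K. dist (g z) (f z) < e} \<subseteq> U"
      unfolding hol_open_def by meson
    with \<open>U \<in> \<U>\<close> show "\<exists>K e. compact K \<and> K \<subseteq> \<Omega> \<and> 0 < e \<and>
        {g \<in> hol_funs \<Omega>. \<forall>z\<in>K. dist (g z) (f z) < e} \<subseteq> \<Union>\<U>"
      by blast
  qed
qed

definition hol_algebra :: "complex set \<Rightarrow> (complex \<Rightarrow> complex) topology" where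
  "hol_algebra \<Omega> = topology (hol_open \<Omega>)"

lemma openin_hol_algebra: "openin (hol_algebra \<Omega>) U \<longleftrightarrow> hol_open \<Omega> U"
  unfolding hol_algebra_def using istopology_hol_open by (simp add: topology_inverse')

lemma topspace_hol_algebra: "topspace (hol_algebra \<Omega>) = hol_funs \<Omega>"
proof -
  have "hol_open \<Omega> (hol_funs \<Omega>)"
    unfolding hol_open_def by (auto intro!: exI[of _ "{}"] exI[of _ "1::real"])
  then show ?thesis
    unfolding topspace_def openin_hol_algebra by (auto simp: hol_open_def)
qed

text \<open>Below, \<open>A\<close> is a topology on a set \<open>topspace A\<close> of complex-valued functions that is a topological
  algebra under the pointwise operations. Operators are required to be \<open>extensional\<close>, so that
  operators agreeing on \<open>topspace A\<close> are equal.\<close>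

definition cont_lin_ops ::
    "('a \<Rightarrow> complex) topology \<Rightarrow> (('a \<Rightarrow> complex) \<Rightarrow> ('a \<Rightarrow> complex)) set" where
  "cont_lin_ops A = {T \<in> extensional (topspace A). continuous_map A A T \<and>
     (\<forall>f\<in>topspace A. \<forall>g\<in>topspace A. T (\<lambda>z. f z + g z) = (\<lambda>z. T f z + T g z)) \<and>
     (\<forall>c. \<forall>f\<in>topspace A. T (\<lambda>z. c * f z) = (\<lambda>z. c * T f z))}"

definition alg_aut ::
    "('a \<Rightarrow> complex) topology \<Rightarrow> (('a \<Rightarrow> complex) \<Rightarrow> ('a \<Rightarrow> complex)) set" where
  "alg_aut A = {T \<in> cont_lin_ops A. bij_betw T (topspace A) (topspace A) \<and>
     (\<forall>f\<in>topspace A. \<forall>g\<in>topspace A. T (\<lambda>z. f z * g z) = (\<lambda>z. T f z * T g z))}"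

definition ref_to ::
    "('a \<Rightarrow> complex) topology \<Rightarrow> (('a \<Rightarrow> complex) \<Rightarrow> ('a \<Rightarrow> complex)) set \<Rightarrow>
      (('a \<Rightarrow> complex) \<Rightarrow> ('a \<Rightarrow> complex)) set" where
  "ref_to A S = {T \<in> cont_lin_ops A. \<forall>f\<in>topspace A. T f \<in> A closure_of {L f |L. L \<in> S}}"

definition topologically_reflexive ::
    "('a \<Rightarrow> complex) topology \<Rightarrow> (('a \<Rightarrow> complex) \<Rightarrow> ('a \<Rightarrow> complex)) set \<Rightarrow> bool" where
  "topologically_reflexive A S \<longleftrightarrow> ref_to A S = S"

end

theory Submission
  imports Defs "HOL-Computational_Algebra.Fundamental_Theorem_Algebra"
begin

text \<open>
  Suppose first that \<open>\<Omega>\<close> is the whole plane. The automorphisms \<open>f(z) \<mapsto> f(cz)\<close> with \<open>c \<noteq> 0\<close> degenerate, as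
  \<open>c \<rightarrow> 0\<close>, to the operator \<open>f \<mapsto> f(0)\<close>. It lies in the topological reflexive closure of the automorphism
  group but is far from surjective, so the group is not reflexive (\<open>not_reflexive_plane\<close>).

  Otherwise the Riemann mapping theorem provides a biholomorphic \<open>h\<close> from \<open>\<Omega>\<close> onto the unit disc, with
  inverse \<open>g\<close>, and the point is that \<open>h\<close> is a bounded function generating a dense subalgebra. Let \<open>T\<close> be
  in the reflexive closure and \<open>z \<in> \<Omega>\<close>. An automorphism preserves the range of a function, because the
  range of \<open>f\<close> is the set of all \<open>c\<close> for which \<open>f - c\<close> is not invertible. Hence the functional
  \<open>\<delta>(f) = (T f)(z)\<close> takes its value at \<open>f\<close> in the closure of the range of \<open>f\<close>. The argument of Gleason,
  Kahane and Zelazko, in a form that tolerates closures, shows that such a functional is multiplicative on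
  bounded functions (\<open>spectral_functional_mult\<close>). So \<open>\<delta>(h^n) = \<delta>(h)^n\<close>. Continuity of \<open>\<delta>\<close> then forces
  \<open>\<bar>\<delta>(h)\<bar> < 1\<close>, since the powers of \<open>h\<close> tend to \<open>0\<close> on every compact set, and density of the polynomials
  in \<open>h\<close> gives \<open>T f = f \<circ> \<phi>\<close> for \<open>\<phi> = g \<circ> T h\<close> (\<open>spectral_operator_eq\<close>).

  It remains to see that \<open>\<phi>\<close> is bijective, or equivalently that the self-map \<open>u = h \<circ> \<phi> \<circ> g\<close> of the disc
  is. The automorphisms of the algebra are themselves covered by the above, and for them this self-map is
  a disc automorphism, hence preserves the pseudo-hyperbolic distance of any \<open>w\<close> to \<open>0\<close>. For each \<open>w\<close> this
  is a condition on the values at two points, so it survives in the limit and holds for \<open>u\<close>; by the equality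
  case of the Schwarz lemma \<open>u\<close> is a disc automorphism (\<open>disc_isometry_bij\<close>).
\<close>

section \<open>Functionals whose values are nearly attained\<close>

text \<open>If \<open>s\<^sub>i\<close> are the inverse roots of \<open>q\<close>, then \<open>q = \<Prod> (1 - s\<^sub>i X)\<close>, and by Newton's identity the
  quantity on the left is the power sum \<open>\<Sum> s\<^sub>i\<^sup>2\<close>, each term of which is at most \<open>M\<^sup>2\<close>. Splitting off one root
  at a time avoids speaking about the family of all roots.\<close>

lemma newton_coeff_bound:
  fixes q :: "complex poly"
  assumes "poly q 0 = 1" and "\<And>r. poly q r = 0 \<Longrightarrow> 1 \<le> M * cmod r" and "0 \<le> M"
  shows "cmod ((coeff q 1)\<^sup>2 - 2 * coeff q 2) \<le> real (degree q) * M\<^sup>2"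
  using assms
proof (induction "degree q" arbitrary: q)
  case 0
  then obtain c where "q = [:c:]" by (metis degree_eq_zeroE)
  then show ?case by (simp add: numeral_2_eq_2)
next
  case (Suc n)
  have "\<nexists>a l. a \<noteq> 0 \<and> l = 0 \<and> q = pCons a l"
    using Suc.hyps(2) by auto
  then obtain r where r: "poly q r = 0"
    using fundamental_theorem_of_algebra_alt by blast
  with Suc.prems(1) have r0: "r \<noteq> 0" by auto
  from r obtain p where p: "q = [:-r, 1:] * p"
    by (auto simp: poly_eq_0_iff_dvd dvd_def)
  define s where "s = smult (-r) p"
  have q: "q = [:1, - inverse r:] * s"
    using r0 by (simp add: p s_def smult_add_right)
  have "s \<noteq> 0"
    using q Suc.hyps(2) by auto
  then have "degree q = degree [:1, - inverse r:] + degree s"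
    unfolding q using r0 by (intro degree_mult_eq) auto
  then have deg: "degree q = Suc (degree s)"
    using r0 by simp
  have IH: "cmod ((coeff s 1)\<^sup>2 - 2 * coeff s 2) \<le> real (degree s) * M\<^sup>2"
  proof (rule Suc.hyps(1))
    show "n = degree s" using deg Suc.hyps(2) by simp
    show "poly s 0 = 1" using Suc.prems(1) by (simp add: q)
    show "1 \<le> M * cmod x" if "poly s x = 0" for x
      using Suc.prems(2)[of x] that by (simp add: q)
  qed (use Suc.prems in auto)
  have s0: "coeff s 0 = 1"
    using Suc.prems(1) by (simp add: q poly_0_coeff_0)
  have "(coeff q 1)\<^sup>2 - 2 * coeff q 2 = ((coeff s 1)\<^sup>2 - 2 * coeff s 2) + (inverse r)\<^sup>2"
    using s0 by (simp add: q coeff_pCons numeral_2_eq_2 power2_eq_square algebra_simps)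
  moreover have "cmod ((inverse r)\<^sup>2) \<le> M\<^sup>2"
  proof -
    have "1 / cmod r \<le> M"
      using Suc.prems(2)[OF r] r0 by (simp add: field_simps)
    then show ?thesis
      using r0 by (simp add: norm_power norm_divide inverse_eq_divide power_mono)
  qed
  ultimately have "cmod ((coeff q 1)\<^sup>2 - 2 * coeff q 2) \<le> real (degree s) * M\<^sup>2 + M\<^sup>2"
    using IH norm_triangle_mono by metis
  then show ?case
    by (simp add: deg algebra_simps)
qed

text \<open>Elements of \<^const>\<open>hol_funs\<close> vanish off \<open>\<Omega>\<close>, so expressions such as \<open>1 - c f\<close> or \<open>f \<circ> \<phi>\<close> have to be
  cut off before they denote an element of the algebra.\<close>

definition zext :: "complex set \<Rightarrow> (complex \<Rightarrow> complex) \<Rightarrow> complex \<Rightarrow> complex" where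
  "zext \<Omega> f = (\<lambda>z. if z \<in> \<Omega> then f z else 0)"

lemma zext_apply [simp]: "z \<in> \<Omega> \<Longrightarrow> zext \<Omega> f z = f z"
  by (simp add: zext_def)

lemma zext_outside [simp]: "z \<notin> \<Omega> \<Longrightarrow> zext \<Omega> f z = 0"
  by (simp add: zext_def)

lemma zext_in_hol_funs [intro]:
  assumes "f holomorphic_on \<Omega>" shows "zext \<Omega> f \<in> hol_funs \<Omega>"
proof -
  have "zext \<Omega> f holomorphic_on \<Omega>"
    by (rule holomorphic_transform[OF assms]) simp
  then show ?thesis by (simp add: hol_funs_def)
qed

lemma hol_funs_holomorphic: "f \<in> hol_funs \<Omega> \<Longrightarrow> f holomorphic_on \<Omega>"
  by (simp add: hol_funs_def)

lemma hol_funs_outside: "f \<in> hol_funs \<Omega> \<Longrightarrow> z \<notin> \<Omega> \<Longrightarrow> f z = 0"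
  by (simp add: hol_funs_def)

lemma zext_hol_funs: "f \<in> hol_funs \<Omega> \<Longrightarrow> zext \<Omega> f = f"
  by (auto simp: hol_funs_def zext_def)

definition hol_functional :: "complex set \<Rightarrow> ((complex \<Rightarrow> complex) \<Rightarrow> complex) \<Rightarrow> bool" where
  "hol_functional \<Omega> \<delta> \<longleftrightarrow>
     (\<forall>f\<in>hol_funs \<Omega>. \<forall>g\<in>hol_funs \<Omega>. \<delta> (\<lambda>z. f z + g z) = \<delta> f + \<delta> g) \<and>
     (\<forall>c. \<forall>f\<in>hol_funs \<Omega>. \<delta> (\<lambda>z. c * f z) = c * \<delta> f)"

lemma hol_functional_add:
  assumes "hol_functional \<Omega> \<delta>" "f holomorphic_on \<Omega>" "g holomorphic_on \<Omega>"
  shows "\<delta> (zext \<Omega> (\<lambda>z. f z + g z)) = \<delta> (zext \<Omega> f) + \<delta> (zext \<Omega> g)"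
proof -
  have "zext \<Omega> (\<lambda>z. f z + g z) = (\<lambda>z. zext \<Omega> f z + zext \<Omega> g z)"
    by (auto simp: zext_def)
  then show ?thesis
    using assms zext_in_hol_funs unfolding hol_functional_def by presburger
qed

lemma hol_functional_scale:
  assumes "hol_functional \<Omega> \<delta>" "f holomorphic_on \<Omega>"
  shows "\<delta> (zext \<Omega> (\<lambda>z. c * f z)) = c * \<delta> (zext \<Omega> f)"
proof -
  have "zext \<Omega> (\<lambda>z. c * f z) = (\<lambda>z. c * zext \<Omega> f z)"
    by (auto simp: zext_def)
  then show ?thesis
    using assms zext_in_hol_funs unfolding hol_functional_def by presburger
qed

lemma hol_functional_zero:
  assumes "hol_functional \<Omega> \<delta>" shows "\<delta> (zext \<Omega> (\<lambda>z. 0)) = 0"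
  using hol_functional_scale[OF assms, of "\<lambda>z. 0" 0] by simp

lemma hol_functional_diff:
  assumes "hol_functional \<Omega> \<delta>" "f holomorphic_on \<Omega>" "g holomorphic_on \<Omega>"
  shows "\<delta> (zext \<Omega> (\<lambda>z. f z - g z)) = \<delta> (zext \<Omega> f) - \<delta> (zext \<Omega> g)"
  using hol_functional_add[OF assms(1,2), of "\<lambda>z. - 1 * g z"]
    hol_functional_scale[OF assms(1,3), of "-1"] assms(3)
  by (simp add: holomorphic_on_minus)

lemma hol_functional_sum:
  assumes "hol_functional \<Omega> \<delta>" and "finite I" and "\<And>k. k \<in> I \<Longrightarrow> f k holomorphic_on \<Omega>"
  shows "\<delta> (zext \<Omega> (\<lambda>z. \<Sum>k\<in>I. c k * f k z)) = (\<Sum>k\<in>I. c k * \<delta> (zext \<Omega> (f k)))"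
  using assms(2,3)
proof (induction I)
  case empty
  then show ?case by (simp add: hol_functional_zero[OF assms(1)])
next
  case (insert k I)
  have "\<delta> (zext \<Omega> (\<lambda>z. c k * f k z + (\<Sum>k\<in>I. c k * f k z)))
      = \<delta> (zext \<Omega> (\<lambda>z. c k * f k z)) + \<delta> (zext \<Omega> (\<lambda>z. \<Sum>k\<in>I. c k * f k z))"
    using insert.prems by (intro hol_functional_add assms(1) holomorphic_intros) auto
  then show ?case
    using insert by (simp add: hol_functional_scale[OF assms(1)])
qed

lemma spectral_functional_one:
  assumes spec: "\<And>f. f \<in> hol_funs \<Omega> \<Longrightarrow> \<delta> f \<in> closure (f ` \<Omega>)"
  shows "\<delta> (zext \<Omega> (\<lambda>z. 1)) = 1"
proof -
  have "zext \<Omega> (\<lambda>z. 1) ` \<Omega> \<subseteq> {1}" by auto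
  then have "closure (zext \<Omega> (\<lambda>z. 1) ` \<Omega>) \<subseteq> {1}"
    by (rule closure_minimal) simp
  moreover have "\<delta> (zext \<Omega> (\<lambda>z. 1)) \<in> closure (zext \<Omega> (\<lambda>z. 1) ` \<Omega>)"
    by (intro spec zext_in_hol_funs holomorphic_on_const)
  ultimately show ?thesis by blast
qed

text \<open>For each \<open>n\<close> the expression \<open>\<delta>((1 - x f)^n)\<close> is a polynomial in \<open>x\<close> of degree at most \<open>n\<close>. If
  \<open>\<bar>x\<bar> M < 1\<close>, the function \<open>(1 - x f)^n\<close> is bounded away from \<open>0\<close>, so that its image under \<open>\<delta>\<close>, a limit of
  its values, is nonzero: all roots are at least \<open>1/M\<close> in modulus. The coefficient bound above, applied to
  the coefficients \<open>-n \<delta>(f)\<close> and \<open>n (n - 1) \<delta>(f\<^sup>2) / 2\<close>, says that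
  \<open>n\<^sup>2 (\<delta>(f)\<^sup>2 - \<delta>(f\<^sup>2)) + n \<delta>(f\<^sup>2)\<close> is only \<open>O(n)\<close>, which for large \<open>n\<close> leaves no choice but
  \<open>\<delta>(f)\<^sup>2 = \<delta>(f\<^sup>2)\<close>.\<close>

lemma spectral_functional_square:
  assumes lin: "hol_functional \<Omega> \<delta>"
    and spec: "\<And>f. f \<in> hol_funs \<Omega> \<Longrightarrow> \<delta> f \<in> closure (f ` \<Omega>)"
    and f: "f holomorphic_on \<Omega>" and bound: "\<And>z. z \<in> \<Omega> \<Longrightarrow> cmod (f z) \<le> M"
  shows "\<delta> (zext \<Omega> (\<lambda>z. (f z)\<^sup>2)) = (\<delta> (zext \<Omega> f))\<^sup>2"
proof -
  have one: "\<delta> (zext \<Omega> (\<lambda>z. 1)) = 1"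
    by (rule spectral_functional_one[OF spec])
  have "\<Omega> \<noteq> {}"
    using spec[of "zext \<Omega> (\<lambda>z. 1)"] zext_in_hol_funs[of "\<lambda>z. 1" \<Omega>] by auto
  then have M0: "0 \<le> M"
    using bound by (meson all_not_in_conv norm_ge_zero order_trans)
  define a where "a = \<delta> (zext \<Omega> f)"
  define b where "b = \<delta> (zext \<Omega> (\<lambda>z. (f z)\<^sup>2))"
  have key: "cmod (of_nat n * (a\<^sup>2 - b) + b) \<le> M\<^sup>2" if "n > 0" for n :: nat
  proof -
    define c where "c k = of_nat (n choose k) * (-1) ^ k * \<delta> (zext \<Omega> (\<lambda>z. f z ^ k))" for k
    define q where "q = (\<Sum>k\<le>n. monom (c k) k)"
    have poly_q: "poly q x = \<delta> (zext \<Omega> (\<lambda>z. (1 - x * f z) ^ n))" for x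
    proof -
      have "(1 - x * f z) ^ n = (\<Sum>k\<le>n. (of_nat (n choose k) * (-1) ^ k * x ^ k) * f z ^ k)" for z
        using binomial_ring[of "- (x * f z)" 1 n]
        by (simp add: power_minus[of "x * f z"] power_mult_distrib mult_ac)
      then have "\<delta> (zext \<Omega> (\<lambda>z. (1 - x * f z) ^ n))
          = (\<Sum>k\<le>n. (of_nat (n choose k) * (-1) ^ k * x ^ k) * \<delta> (zext \<Omega> (\<lambda>z. f z ^ k)))"
        using hol_functional_sum[OF lin, of "{..n}" "\<lambda>k z. f z ^ k"
            "\<lambda>k. of_nat (n choose k) * (-1) ^ k * x ^ k"] f
        by (simp add: holomorphic_intros)
      then show ?thesis
        by (simp add: q_def c_def poly_sum poly_monom mult_ac)
    qed
    have coeff_q: "coeff q k = c k" for k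
      by (cases "k \<le> n") (auto simp: q_def coeff_sum c_def binomial_eq_0 if_distrib cong: if_cong)
    have "cmod ((coeff q 1)\<^sup>2 - 2 * coeff q 2) \<le> real (degree q) * M\<^sup>2"
    proof (rule newton_coeff_bound[OF _ _ M0])
      show "poly q 0 = 1" by (simp add: poly_q one)
      fix r assume r: "poly q r = 0"
      show "1 \<le> M * cmod r"
      proof (rule ccontr)
        assume "\<not> ?thesis"
        then have small: "M * cmod r < 1" by simp
        define d where "d = (1 - M * cmod r) ^ n"
        have "d > 0" using small by (simp add: d_def)
        have "zext \<Omega> (\<lambda>z. (1 - r * f z) ^ n) ` \<Omega> \<subseteq> - ball 0 d"
        proof clarsimp
          fix z assume z: "z \<in> \<Omega>" and lt: "cmod ((1 - r * f z) ^ n) < d"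
          have "cmod (r * f z) \<le> M * cmod r"
            using bound[OF z] by (simp add: norm_mult mult.commute[of M] mult_left_mono)
          then have "1 - M * cmod r \<le> cmod (1 - r * f z)"
            using norm_triangle_ineq2[of 1 "r * f z"] by simp
          then have "d \<le> cmod ((1 - r * f z) ^ n)"
            unfolding d_def norm_power using small by (intro power_mono) auto
          with lt show False by simp
        qed
        then have "closure (zext \<Omega> (\<lambda>z. (1 - r * f z) ^ n) ` \<Omega>) \<subseteq> - ball 0 d"
          by (rule closure_minimal) (simp add: closed_Compl)
        moreover have "0 \<in> closure (zext \<Omega> (\<lambda>z. (1 - r * f z) ^ n) ` \<Omega>)"
          using spec[of "zext \<Omega> (\<lambda>z. (1 - r * f z) ^ n)"] r f
          by (simp add: poly_q holomorphic_intros zext_in_hol_funs)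
        ultimately show False using \<open>d > 0\<close> by auto
      qed
    qed
    also have "\<dots> \<le> real n * M\<^sup>2"
    proof -
      have "degree q \<le> n"
        by (rule degree_le) (auto simp: coeff_q c_def binomial_eq_0)
      then show ?thesis by (simp add: mult_right_mono)
    qed
    finally have le: "cmod ((coeff q 1)\<^sup>2 - 2 * coeff q 2) \<le> real n * M\<^sup>2" .
    have c1: "coeff q 1 = - (of_nat n * a)"
      by (simp add: coeff_q c_def a_def)
    have "2 * (n choose 2) = n * (n - 1)"
      by (cases "even n") (auto simp: choose_two)
    then have "(2::complex) * of_nat (n choose 2) = of_nat n * of_nat (n - 1)"
      by (metis of_nat_mult of_nat_numeral)
    then have c2: "2 * coeff q 2 = of_nat n * (of_nat n - 1) * b"
      using \<open>n > 0\<close> by (simp add: coeff_q c_def b_def of_nat_diff mult.assoc[symmetric])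
    have "(coeff q 1)\<^sup>2 - 2 * coeff q 2 = of_nat n * (of_nat n * (a\<^sup>2 - b) + b)"
      unfolding c1 c2 by (simp add: power2_eq_square algebra_simps)
    then have "real n * cmod (of_nat n * (a\<^sup>2 - b) + b) \<le> real n * M\<^sup>2"
      using le by (simp add: norm_mult)
    then show ?thesis using \<open>n > 0\<close> by simp
  qed
  have "a\<^sup>2 - b = 0"
  proof (rule ccontr)
    assume ne: "a\<^sup>2 - b \<noteq> 0"
    then have "0 < cmod (a\<^sup>2 - b)" by simp
    then obtain n :: nat where n: "M\<^sup>2 + cmod b < real n * cmod (a\<^sup>2 - b)"
      using ex_less_of_nat_mult by blast
    have "0 \<le> M\<^sup>2 + cmod b" by simp
    with n have "n > 0" by (cases "n = 0") auto
    moreover have "real n * cmod (a\<^sup>2 - b) \<le> cmod (of_nat n * (a\<^sup>2 - b) + b) + cmod b"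
      using norm_triangle_ineq4[of "of_nat n * (a\<^sup>2 - b) + b" b] by (simp add: norm_mult)
    ultimately show False using n key[of n] by linarith
  qed
  then show ?thesis by (simp add: a_def b_def)
qed

text \<open>Polarization of the preceding identity.\<close>

lemma spectral_functional_mult:
  assumes lin: "hol_functional \<Omega> \<delta>"
    and spec: "\<And>f. f \<in> hol_funs \<Omega> \<Longrightarrow> \<delta> f \<in> closure (f ` \<Omega>)"
    and f: "f holomorphic_on \<Omega>" "\<And>z. z \<in> \<Omega> \<Longrightarrow> cmod (f z) \<le> M"
    and g: "g holomorphic_on \<Omega>" "\<And>z. z \<in> \<Omega> \<Longrightarrow> cmod (g z) \<le> N"
  shows "\<delta> (zext \<Omega> (\<lambda>z. f z * g z)) = \<delta> (zext \<Omega> f) * \<delta> (zext \<Omega> g)"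
proof -
  note square = spectral_functional_square[OF lin spec]
  have bound: "cmod (f z + g z) \<le> M + N" if "z \<in> \<Omega>" for z
    using norm_triangle_mono[OF f(2)[OF that] g(2)[OF that]] .
  have "\<delta> (zext \<Omega> (\<lambda>z. (f z + g z)\<^sup>2))
      = \<delta> (zext \<Omega> (\<lambda>z. ((f z)\<^sup>2 + (g z)\<^sup>2) + 2 * (f z * g z)))"
    by (simp add: power2_sum mult.assoc)
  also have "\<dots> = (\<delta> (zext \<Omega> (\<lambda>z. (f z)\<^sup>2)) + \<delta> (zext \<Omega> (\<lambda>z. (g z)\<^sup>2)))
      + 2 * \<delta> (zext \<Omega> (\<lambda>z. f z * g z))"
    using f(1) g(1) by (simp add: hol_functional_add[OF lin] hol_functional_scale[OF lin] holomorphic_intros)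
  also have "\<delta> (zext \<Omega> (\<lambda>z. (f z)\<^sup>2)) = (\<delta> (zext \<Omega> f))\<^sup>2"
    by (rule square) (use f in auto)
  also have "\<delta> (zext \<Omega> (\<lambda>z. (g z)\<^sup>2)) = (\<delta> (zext \<Omega> g))\<^sup>2"
    by (rule square) (use g in auto)
  also have "\<delta> (zext \<Omega> (\<lambda>z. (f z + g z)\<^sup>2)) = (\<delta> (zext \<Omega> (\<lambda>z. f z + g z)))\<^sup>2"
    by (rule square) (use f(1) g(1) bound in \<open>auto intro!: holomorphic_intros\<close>)
  finally show ?thesis
    using f(1) g(1) by (simp add: hol_functional_add[OF lin] power2_eq_square algebra_simps)
qed

section \<open>Operators on the algebra of holomorphic functions\<close>

lemma hol_functional_eval:
  assumes "T \<in> cont_lin_ops (hol_algebra \<Omega>)"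
  shows "hol_functional \<Omega> (\<lambda>f. T f z)"
  using assms unfolding hol_functional_def cont_lin_ops_def topspace_hol_algebra by simp

lemma cont_lin_ops_range:
  assumes "T \<in> cont_lin_ops (hol_algebra \<Omega>)" and "f \<in> hol_funs \<Omega>"
  shows "T f \<in> hol_funs \<Omega>"
  using assms unfolding cont_lin_ops_def continuous_map topspace_hol_algebra by auto

text \<open>The set of all \<open>g\<close> with \<open>dist (g z) (f z) < e\<close> on \<open>K\<close> is also open, but seeing this requires the
  maximum of \<open>dist (g z) (f z)\<close> over \<open>K\<close>. Asking for a uniform bound \<open>d < e\<close> instead makes openness evident,
  even for empty \<open>K\<close>.\<close>

lemma hol_open_basic:
  assumes "open \<Omega>" and "compact K" and "K \<subseteq> \<Omega>" and "0 < e" and f: "f \<in> hol_funs \<Omega>"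
  obtains U where "hol_open \<Omega> U" and "f \<in> U" and "\<And>g z. g \<in> U \<Longrightarrow> z \<in> K \<Longrightarrow> dist (g z) (f z) < e"
proof
  let ?U = "{g \<in> hol_funs \<Omega>. \<exists>d<e. \<forall>z\<in>K. dist (g z) (f z) \<le> d}"
  show "hol_open \<Omega> ?U"
    unfolding hol_open_def
  proof (intro conjI ballI)
    fix g assume "g \<in> ?U"
    then obtain d where g: "g \<in> hol_funs \<Omega>" and d: "d < e" "\<And>z. z \<in> K \<Longrightarrow> dist (g z) (f z) \<le> d"
      by auto
    have "{k \<in> hol_funs \<Omega>. \<forall>z\<in>K. dist (k z) (g z) < (e - d) / 2} \<subseteq> ?U"
    proof clarsimp
      fix k assume k: "\<forall>z\<in>K. dist (k z) (g z) * 2 < e - d"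
      have "dist (k z) (f z) \<le> (e + d) / 2" if "z \<in> K" for z
        using dist_triangle[of "k z" "f z" "g z"] d(2)[OF that] bspec[OF k that] by argo
      then show "\<exists>d<e. \<forall>z\<in>K. dist (k z) (f z) \<le> d"
        using d(1) by (intro exI[of _ "(e + d) / 2"]) auto
    qed
    then show "\<exists>K e. compact K \<and> K \<subseteq> \<Omega> \<and> 0 < e \<and>
        {k \<in> hol_funs \<Omega>. \<forall>z\<in>K. dist (k z) (g z) < e} \<subseteq> ?U"
      using assms(2,3) d(1) by (intro exI[of _ K] exI[of _ "(e - d) / 2"]) auto
  qed auto
  show "f \<in> ?U"
    using f \<open>0 < e\<close> by (auto intro!: exI[of _ "0::real"])
qed fastforce

text \<open>By homogeneity this is the usual estimate of a continuous functional by a multiple of the supremum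
  over a compact set; the unscaled form is the one that is needed.\<close>

lemma cont_lin_ops_eval_bound:
  assumes "open \<Omega>" and T: "T \<in> cont_lin_ops (hol_algebra \<Omega>)" and z: "z \<in> \<Omega>"
  obtains K e where "compact K" "K \<subseteq> \<Omega>" "0 < e"
    "\<And>f. f \<in> hol_funs \<Omega> \<Longrightarrow> (\<And>w. w \<in> K \<Longrightarrow> cmod (f w) < e) \<Longrightarrow> cmod (T f z) < 1"
proof -
  have 0: "(\<lambda>_. 0) \<in> hol_funs \<Omega>"
    by (simp add: hol_funs_def)
  then have T0: "T (\<lambda>_. 0) = (\<lambda>_. 0)"
    using T unfolding cont_lin_ops_def topspace_hol_algebra by (fastforce dest: spec[of _ 0])
  obtain U where U: "hol_open \<Omega> U" "(\<lambda>_. 0) \<in> U"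
      "\<And>g w. g \<in> U \<Longrightarrow> w \<in> {z} \<Longrightarrow> dist (g w) 0 < 1"
    using hol_open_basic[OF assms(1) _ _ _ 0, of "{z}" 1] z by auto
  have "hol_open \<Omega> {f \<in> hol_funs \<Omega>. T f \<in> U}"
    using T U(1) unfolding cont_lin_ops_def continuous_map topspace_hol_algebra openin_hol_algebra
    by auto
  moreover have "(\<lambda>_. 0) \<in> {f \<in> hol_funs \<Omega>. T f \<in> U}"
    using 0 T0 U(2) by simp
  ultimately obtain K e where K: "compact K" "K \<subseteq> \<Omega>" "0 < e"
      "{g \<in> hol_funs \<Omega>. \<forall>z\<in>K. dist (g z) 0 < e} \<subseteq> {f \<in> hol_funs \<Omega>. T f \<in> U}"
    unfolding hol_open_def by meson
  show thesis
    by (rule that[OF K(1-3)]) (use K(4) U(3) in auto)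
qed

lemma composition_in_cont_lin_ops:
  assumes "open \<Omega>" and \<phi>: "\<phi> holomorphic_on \<Omega>" "\<phi> ` \<Omega> \<subseteq> \<Omega>"
  shows "restrict (\<lambda>f. zext \<Omega> (f \<circ> \<phi>)) (hol_funs \<Omega>) \<in> cont_lin_ops (hol_algebra \<Omega>)"
proof -
  let ?T = "restrict (\<lambda>f. zext \<Omega> (f \<circ> \<phi>)) (hol_funs \<Omega>)"
  have in_hol: "zext \<Omega> (f \<circ> \<phi>) \<in> hol_funs \<Omega>" if "f \<in> hol_funs \<Omega>" for f
    using holomorphic_on_compose_gen[OF \<phi>(1) hol_funs_holomorphic[OF that] \<phi>(2)]
    by (rule zext_in_hol_funs)
  have "continuous_map (hol_algebra \<Omega>) (hol_algebra \<Omega>) ?T"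
    unfolding continuous_map topspace_hol_algebra openin_hol_algebra
  proof (intro conjI allI impI)
    show "?T ` hol_funs \<Omega> \<subseteq> hol_funs \<Omega>"
      using in_hol by auto
    fix U assume U: "hol_open \<Omega> U"
    show "hol_open \<Omega> {f \<in> hol_funs \<Omega>. ?T f \<in> U}"
      unfolding hol_open_def
    proof (intro conjI ballI)
      fix f assume "f \<in> {f \<in> hol_funs \<Omega>. ?T f \<in> U}"
      then have f: "f \<in> hol_funs \<Omega>" "zext \<Omega> (f \<circ> \<phi>) \<in> U" by auto
      then obtain K e where K: "compact K" "K \<subseteq> \<Omega>" "0 < e"
          and sub: "{g \<in> hol_funs \<Omega>. \<forall>z\<in>K. dist (g z) (zext \<Omega> (f \<circ> \<phi>) z) < e} \<subseteq> U"
        using U unfolding hol_open_def by meson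
      have "compact (\<phi> ` K)"
        using K \<phi>(1) by (meson compact_continuous_image continuous_on_subset holomorphic_on_imp_continuous_on)
      moreover have "\<phi> ` K \<subseteq> \<Omega>"
        using K \<phi>(2) by blast
      moreover have "{g \<in> hol_funs \<Omega>. \<forall>z\<in>\<phi> ` K. dist (g z) (f z) < e} \<subseteq> {f \<in> hol_funs \<Omega>. ?T f \<in> U}"
      proof clarsimp
        fix g assume g: "g \<in> hol_funs \<Omega>" "\<forall>z\<in>K. dist (g (\<phi> z)) (f (\<phi> z)) < e"
        then have "\<forall>z\<in>K. dist (zext \<Omega> (g \<circ> \<phi>) z) (zext \<Omega> (f \<circ> \<phi>) z) < e"
          using K(2) by (auto simp: zext_def)
        then show "zext \<Omega> (g \<circ> \<phi>) \<in> U"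
          using sub in_hol[OF g(1)] by blast
      qed
      ultimately show "\<exists>K e. compact K \<and> K \<subseteq> \<Omega> \<and> 0 < e \<and>
          {g \<in> hol_funs \<Omega>. \<forall>z\<in>K. dist (g z) (f z) < e} \<subseteq> {f \<in> hol_funs \<Omega>. ?T f \<in> U}"
        using K(3) by blast
    qed auto
  qed
  moreover have "(\<lambda>z. f z + g z) \<in> hol_funs \<Omega>" "(\<lambda>z. c * f z) \<in> hol_funs \<Omega>"
    if "f \<in> hol_funs \<Omega>" "g \<in> hol_funs \<Omega>" for f g c
    using that by (auto simp: hol_funs_def intro!: holomorphic_intros)
  ultimately show ?thesis
    unfolding cont_lin_ops_def topspace_hol_algebra by (auto simp: zext_def)
qed

lemma composition_in_alg_aut:
  assumes "open \<Omega>" and T: "T \<in> cont_lin_ops (hol_algebra \<Omega>)"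
    and \<phi>: "\<phi> holomorphic_on \<Omega>" "bij_betw \<phi> \<Omega> \<Omega>"
    and T_eq: "\<And>f. f \<in> hol_funs \<Omega> \<Longrightarrow> T f = zext \<Omega> (f \<circ> \<phi>)"
  shows "T \<in> alg_aut (hol_algebra \<Omega>)"
proof -
  have img: "\<phi> ` \<Omega> = \<Omega>" and inj: "inj_on \<phi> \<Omega>"
    using \<phi>(2) by (auto simp: bij_betw_def)
  obtain \<psi> where \<psi>: "\<psi> holomorphic_on \<Omega>" "\<And>z. z \<in> \<Omega> \<Longrightarrow> \<psi> (\<phi> z) = z"
    using holomorphic_has_inverse[OF \<phi>(1) assms(1) inj] img by metis
  have \<psi>_in: "\<psi> ` \<Omega> \<subseteq> \<Omega>"
    using \<psi>(2) img by (metis image_eqI image_iff image_subsetI)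
  have \<phi>\<psi>: "\<phi> (\<psi> z) = z" if "z \<in> \<Omega>" for z
    using \<psi>(2) img that by (metis imageE)
  have "bij_betw T (hol_funs \<Omega>) (hol_funs \<Omega>)"
  proof (rule bij_betw_byWitness[where f' = "\<lambda>f. zext \<Omega> (f \<circ> \<psi>)"])
    show "T ` hol_funs \<Omega> \<subseteq> hol_funs \<Omega>"
      using cont_lin_ops_range[OF T] by auto
    show psi_hol: "(\<lambda>f. zext \<Omega> (f \<circ> \<psi>)) ` hol_funs \<Omega> \<subseteq> hol_funs \<Omega>"
      using holomorphic_on_compose_gen[OF \<psi>(1) hol_funs_holomorphic \<psi>_in] by blast
    show "\<forall>f\<in>hol_funs \<Omega>. zext \<Omega> (T f \<circ> \<psi>) = f"
      using \<psi>_in \<phi>\<psi> T_eq by (auto simp: fun_eq_iff zext_def hol_funs_outside)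
    show "\<forall>f\<in>hol_funs \<Omega>. T (zext \<Omega> (f \<circ> \<psi>)) = f"
    proof
      fix f assume f: "f \<in> hol_funs \<Omega>"
      then have "T (zext \<Omega> (f \<circ> \<psi>)) = zext \<Omega> (zext \<Omega> (f \<circ> \<psi>) \<circ> \<phi>)"
        using psi_hol by (intro T_eq) blast
      also have "\<dots> = f"
        using f img \<psi>(2) by (auto simp: fun_eq_iff zext_def hol_funs_outside)
      finally show "T (zext \<Omega> (f \<circ> \<psi>)) = f" .
    qed
  qed
  moreover have "T (\<lambda>z. f z * g z) = (\<lambda>z. T f z * T g z)"
    if "f \<in> hol_funs \<Omega>" "g \<in> hol_funs \<Omega>" for f g
  proof -
    have "(\<lambda>z. f z * g z) \<in> hol_funs \<Omega>"
      using that by (auto simp: hol_funs_def intro!: holomorphic_intros)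
    then show ?thesis
      using that by (auto simp: T_eq zext_def)
  qed
  ultimately show ?thesis
    using T by (simp add: alg_aut_def topspace_hol_algebra)
qed

text \<open>The image of the unit acts as a unit on the range of the automorphism, which is everything.\<close>

lemma alg_aut_one:
  assumes "T \<in> alg_aut (hol_algebra \<Omega>)"
  shows "T (zext \<Omega> (\<lambda>_. 1)) = zext \<Omega> (\<lambda>_. 1)"
proof -
  let ?one = "zext \<Omega> (\<lambda>_. 1)"
  have one: "?one \<in> hol_funs \<Omega>" by (simp add: zext_in_hol_funs)
  have bij: "bij_betw T (hol_funs \<Omega>) (hol_funs \<Omega>)"
    and mult: "\<And>f g. f \<in> hol_funs \<Omega> \<Longrightarrow> g \<in> hol_funs \<Omega> \<Longrightarrow> T (\<lambda>z. f z * g z) = (\<lambda>z. T f z * T g z)"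
    using assms by (auto simp: alg_aut_def topspace_hol_algebra)
  from bij one obtain u where u: "u \<in> hol_funs \<Omega>" "T u = ?one"
    by (metis bij_betw_imp_surj_on imageE)
  have "(\<lambda>z. ?one z * u z) = u"
    using u(1) by (auto simp: fun_eq_iff zext_def hol_funs_outside)
  then have "(\<lambda>z. T ?one z * ?one z) = ?one"
    using mult[OF one u(1)] u(2) by simp
  moreover have "T ?one \<in> hol_funs \<Omega>"
    using bij one by (auto simp: bij_betw_def)
  ultimately show ?thesis
    by (metis (no_types, lifting) ext hol_funs_outside mult.right_neutral zext_def)
qed

text \<open>A value \<open>c\<close> is omitted by \<open>f\<close> on \<open>\<Omega>\<close> if and only if \<open>f - c\<close> is invertible in the algebra, and
  automorphisms preserve invertibility in both directions.\<close>

lemma alg_aut_image: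
  assumes T: "T \<in> alg_aut (hol_algebra \<Omega>)" and f: "f \<in> hol_funs \<Omega>"
  shows "T f ` \<Omega> = f ` \<Omega>"
proof -
  let ?one = "zext \<Omega> (\<lambda>_. 1)"
  have one: "?one \<in> hol_funs \<Omega>" by (simp add: zext_in_hol_funs)
  have bij: "bij_betw T (hol_funs \<Omega>) (hol_funs \<Omega>)"
    and mult: "\<And>f g. f \<in> hol_funs \<Omega> \<Longrightarrow> g \<in> hol_funs \<Omega> \<Longrightarrow> T (\<lambda>z. f z * g z) = (\<lambda>z. T f z * T g z)"
    and lin: "T \<in> cont_lin_ops (hol_algebra \<Omega>)"
    using T by (auto simp: alg_aut_def topspace_hol_algebra)
  have Tf: "T f \<in> hol_funs \<Omega>"
    using cont_lin_ops_range[OF lin f] .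
  have shift: "T (zext \<Omega> (\<lambda>z. f z - c)) = zext \<Omega> (\<lambda>z. T f z - c)" for c
  proof
    fix z
    show "T (zext \<Omega> (\<lambda>z. f z - c)) z = zext \<Omega> (\<lambda>z. T f z - c) z"
    proof (cases "z \<in> \<Omega>")
      case True
      have "T (zext \<Omega> (\<lambda>z. f z - c * 1)) z = T (zext \<Omega> f) z - c * T ?one z"
        using hol_functional_diff[OF hol_functional_eval[OF lin], of f "\<lambda>z. c * 1"]
          hol_functional_scale[OF hol_functional_eval[OF lin], of "\<lambda>z. 1" c]
          hol_funs_holomorphic[OF f] by simp
      then show ?thesis
        using True by (simp add: alg_aut_one[OF T] zext_hol_funs[OF f])
    next
      case False
      have "T (zext \<Omega> (\<lambda>z. f z - c)) \<in> hol_funs \<Omega>"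
        using hol_funs_holomorphic[OF f]
        by (intro cont_lin_ops_range[OF lin] zext_in_hol_funs holomorphic_intros)
      then show ?thesis using False by (simp add: hol_funs_outside)
    qed
  qed
  have fc: "zext \<Omega> (\<lambda>z. f z - c) \<in> hol_funs \<Omega>" for c
    using hol_funs_holomorphic[OF f] by (intro zext_in_hol_funs holomorphic_intros)
  have "c \<notin> T f ` \<Omega>" if c: "c \<notin> f ` \<Omega>" for c
  proof
    assume "c \<in> T f ` \<Omega>"
    then obtain z where z: "z \<in> \<Omega>" "T f z = c" by auto
    let ?r = "zext \<Omega> (\<lambda>z. inverse (f z - c))"
    have "?r \<in> hol_funs \<Omega>"
      using c hol_funs_holomorphic[OF f] by (intro zext_in_hol_funs holomorphic_intros) auto
    moreover have "(\<lambda>z. zext \<Omega> (\<lambda>z. f z - c) z * ?r z) = ?one"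
    proof
      fix z
      have "f z - c \<noteq> 0" if "z \<in> \<Omega>" using c that by auto
      then show "zext \<Omega> (\<lambda>z. f z - c) z * ?r z = ?one z" by (simp add: zext_def)
    qed
    ultimately have "?one = (\<lambda>z. zext \<Omega> (\<lambda>z. T f z - c) z * T ?r z)"
      using mult[OF fc, of ?r c] shift alg_aut_one[OF T] by simp
    then show False
      using z by (auto simp: fun_eq_iff dest!: spec[of _ z])
  qed
  moreover have "c \<notin> f ` \<Omega>" if c: "c \<notin> T f ` \<Omega>" for c
  proof
    assume "c \<in> f ` \<Omega>"
    then obtain z where z: "z \<in> \<Omega>" "f z = c" by auto
    let ?r = "zext \<Omega> (\<lambda>z. inverse (T f z - c))"
    have "?r \<in> hol_funs \<Omega>"
      using c hol_funs_holomorphic[OF Tf] by (intro zext_in_hol_funs holomorphic_intros) auto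
    then obtain u where u: "u \<in> hol_funs \<Omega>" "T u = ?r"
      using bij by (metis bij_betw_imp_surj_on imageE)
    have "T (\<lambda>z. zext \<Omega> (\<lambda>z. f z - c) z * u z) = (\<lambda>z. zext \<Omega> (\<lambda>z. T f z - c) z * ?r z)"
      using mult[OF fc u(1)] by (simp add: shift u(2))
    also have "\<dots> = T ?one"
    proof
      fix z
      have "T f z - c \<noteq> 0" if "z \<in> \<Omega>" using c that by auto
      then show "zext \<Omega> (\<lambda>z. T f z - c) z * ?r z = T ?one z"
        unfolding alg_aut_one[OF T] by (simp add: zext_def)
    qed
    finally have "(\<lambda>z. zext \<Omega> (\<lambda>z. f z - c) z * u z) = ?one"
    proof (rule inj_onD[OF bij_betw_imp_inj_on[OF bij]])
      show "(\<lambda>z. zext \<Omega> (\<lambda>z. f z - c) z * u z) \<in> hol_funs \<Omega>"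
        using fc[of c] u(1) by (auto simp: hol_funs_def intro!: holomorphic_intros)
    qed (rule one)
    then show False
      using z by (auto simp: fun_eq_iff dest!: spec[of _ z])
  qed
  ultimately show ?thesis by blast
qed

section \<open>Operators represented by self-maps of the disc\<close>

text \<open>The Taylor polynomials at \<open>0\<close> converge uniformly on smaller closed discs. The auxiliary radius \<open>s\<close>
  lies strictly between \<open>r\<close> and \<open>1\<close>, so that convergence at \<open>s\<close> puts \<open>r\<close> strictly inside the disc of
  convergence.\<close>

lemma holomorphic_disc_polynomial_approx:
  assumes F: "F holomorphic_on ball 0 1" and r: "0 \<le> r" "r < 1" and "0 < e"
  obtains a :: "nat \<Rightarrow> complex" and n where "\<And>w. w \<in> cball 0 r \<Longrightarrow> cmod (F w - (\<Sum>i<n. a i * w ^ i)) < e"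
proof -
  define a where "a n = (deriv ^^ n) F 0 / fact n" for n
  have sums: "(\<lambda>n. a n * w ^ n) sums F w" if "w \<in> ball 0 1" for w
    using holomorphic_power_series[OF F that] by (simp add: a_def)
  define s where "s = (r + 1) / 2"
  have s: "r < s" "s < 1" "0 \<le> s" using r by (auto simp: s_def)
  have "summable (\<lambda>n. a n * of_real s ^ n)"
    using sums[of "of_real s"] s by (auto simp: sums_iff)
  then have "conv_radius a \<ge> ereal (norm (of_real s :: complex))"
    by (rule conv_radius_geI)
  then have "ereal r < conv_radius a"
    using s by (auto intro: less_le_trans[of _ "ereal s"])
  from powser_uniform_limit[OF this, of 0]
  have "uniform_limit (cball 0 r) (\<lambda>n w. \<Sum>i<n. a i * w ^ i) (\<lambda>w. suminf (\<lambda>i. a i * w ^ i)) sequentially"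
    by simp
  then have "\<forall>\<^sub>F n in sequentially. \<forall>w\<in>cball 0 r. dist (\<Sum>i<n. a i * w ^ i) (suminf (\<lambda>i. a i * w ^ i)) < e"
    using \<open>0 < e\<close> by (rule uniform_limitD)
  then obtain n where n: "\<And>w. w \<in> cball 0 r \<Longrightarrow> dist (\<Sum>i<n. a i * w ^ i) (suminf (\<lambda>i. a i * w ^ i)) < e"
    unfolding eventually_sequentially by blast
  have "cmod (F w - (\<Sum>i<n. a i * w ^ i)) < e" if w: "w \<in> cball 0 r" for w
  proof -
    have "suminf (\<lambda>i. a i * w ^ i) = F w"
      using sums[of w] w r by (auto simp: sums_iff)
    then show ?thesis using n[OF w] by (simp add: dist_norm norm_minus_commute)
  qed
  then show thesis by (rule that)
qed

text \<open>A Riemann map \<open>h\<close> of \<open>\<Omega>\<close> with inverse \<open>g\<close>; \<open>h\<close> is taken as an element of the algebra, so that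
  operators can be applied to it directly.\<close>

locale disc_chart =
  fixes \<Omega> :: "complex set" and h g :: "complex \<Rightarrow> complex"
  assumes open_dom: "open \<Omega>"
    and h_hol: "h \<in> hol_funs \<Omega>" and g_hol: "g holomorphic_on ball 0 1"
    and h_disc: "z \<in> \<Omega> \<Longrightarrow> h z \<in> ball 0 1" and gh: "z \<in> \<Omega> \<Longrightarrow> g (h z) = z"
    and g_dom: "w \<in> ball 0 1 \<Longrightarrow> g w \<in> \<Omega>" and hg: "w \<in> ball 0 1 \<Longrightarrow> h (g w) = w"
begin

lemma h_image: "h ` \<Omega> = ball 0 1"
  using h_disc g_dom hg by (metis image_eqI image_subsetI subset_antisym subsetI)

lemma h_powers_holomorphic: "(\<lambda>z. h z ^ n) holomorphic_on \<Omega>"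
  using hol_funs_holomorphic[OF h_hol] by (intro holomorphic_intros)

lemma h_compact_bound:
  assumes "compact K" "K \<subseteq> \<Omega>"
  obtains r where "0 \<le> r" "r < 1" "\<And>w. w \<in> K \<Longrightarrow> cmod (h w) \<le> r"
proof (cases "K = {}")
  case True
  then show thesis using that[of 0] by auto
next
  case False
  have "continuous_on K (\<lambda>w. cmod (h w))"
    using assms(2) hol_funs_holomorphic[OF h_hol]
    by (intro continuous_on_norm) (meson continuous_on_subset holomorphic_on_imp_continuous_on)
  then obtain w where "w \<in> K" "\<forall>v\<in>K. cmod (h v) \<le> cmod (h w)"
    using continuous_attains_sup[OF assms(1) False] by blast
  then show thesis
    using that[of "cmod (h w)"] h_disc assms(2) by auto
qed

lemma spectral_operator_powers:
  assumes T: "T \<in> cont_lin_ops (hol_algebra \<Omega>)" and z: "z \<in> \<Omega>"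
    and spec: "\<And>f. f \<in> hol_funs \<Omega> \<Longrightarrow> T f z \<in> closure (f ` \<Omega>)"
  shows "T (zext \<Omega> (\<lambda>z. h z ^ n)) z = T h z ^ n"
proof (induction n)
  case 0
  then show ?case
    using spectral_functional_one[of \<Omega> "\<lambda>f. T f z", OF spec] by simp
next
  case (Suc n)
  have "T (zext \<Omega> (\<lambda>z. h z * h z ^ n)) z = T (zext \<Omega> h) z * T (zext \<Omega> (\<lambda>z. h z ^ n)) z"
  proof (rule spectral_functional_mult[OF hol_functional_eval[OF T] spec, where M = 1 and N = 1])
    show "cmod (h w) \<le> 1" if "w \<in> \<Omega>" for w
      using h_disc[OF that] by simp
    show "cmod (h w ^ n) \<le> 1" if "w \<in> \<Omega>" for w
      using h_disc[OF that] by (simp add: norm_power power_le_one)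
  qed (use h_powers_holomorphic hol_funs_holomorphic[OF h_hol] in auto)
  then show ?case
    using Suc by (simp add: zext_hol_funs[OF h_hol])
qed

text \<open>Here the continuity of \<open>T\<close> is decisive: the powers of \<open>h\<close> tend to \<open>0\<close> uniformly on compact sets,
  hence so do the powers of the number \<open>T h z\<close>. This excludes the limits of disc automorphisms that are
  constants of modulus \<open>1\<close>.\<close>

lemma spectral_operator_disc:
  assumes T: "T \<in> cont_lin_ops (hol_algebra \<Omega>)" and z: "z \<in> \<Omega>"
    and spec: "\<And>f. f \<in> hol_funs \<Omega> \<Longrightarrow> T f z \<in> closure (f ` \<Omega>)"
  shows "T h z \<in> ball 0 1"
proof (rule ccontr)
  assume "T h z \<notin> ball 0 1"
  then have ge: "1 \<le> cmod (T h z)" by simp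
  obtain K e where K: "compact K" "K \<subseteq> \<Omega>" "0 < e"
    and bd: "\<And>f. f \<in> hol_funs \<Omega> \<Longrightarrow> (\<And>w. w \<in> K \<Longrightarrow> cmod (f w) < e) \<Longrightarrow> cmod (T f z) < 1"
    using cont_lin_ops_eval_bound[OF open_dom T z] by blast
  obtain r where r: "0 \<le> r" "r < 1" "\<And>w. w \<in> K \<Longrightarrow> cmod (h w) \<le> r"
    using h_compact_bound[OF K(1,2)] by blast
  obtain n where n: "r ^ n < e"
    using real_arch_pow_inv[OF K(3) r(2)] by blast
  have "cmod (T (zext \<Omega> (\<lambda>z. h z ^ n)) z) < 1"
  proof (rule bd)
    show "zext \<Omega> (\<lambda>z. h z ^ n) \<in> hol_funs \<Omega>"
      using h_powers_holomorphic by blast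
    fix w assume w: "w \<in> K"
    then have "cmod (h w ^ n) \<le> r ^ n"
      using r by (simp add: norm_power power_mono)
    then show "cmod (zext \<Omega> (\<lambda>z. h z ^ n) w) < e"
      using w K(2) n by auto
  qed
  then show False
    using ge one_le_power[OF ge, of n]
    by (simp add: spectral_operator_powers[OF assms] norm_power)
qed

text \<open>Both sides are continuous functionals of \<open>f\<close> and agree on the powers of \<open>h\<close>; in the chart,
  polynomials in \<open>h\<close> become polynomials on the disc and are therefore dense.\<close>

lemma spectral_operator_eq:
  assumes T: "T \<in> cont_lin_ops (hol_algebra \<Omega>)" and z: "z \<in> \<Omega>"
    and spec: "\<And>f. f \<in> hol_funs \<Omega> \<Longrightarrow> T f z \<in> closure (f ` \<Omega>)"
    and f: "f \<in> hol_funs \<Omega>"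
  shows "T f z = f (g (T h z))"
proof -
  let ?p = "g (T h z)"
  have disc: "T h z \<in> ball 0 1"
    using spectral_operator_disc[OF T z spec] .
  have p: "?p \<in> \<Omega>" "h ?p = T h z"
    using g_dom[OF disc] hg[OF disc] .
  obtain K e where K: "compact K" "K \<subseteq> \<Omega>" "0 < e"
    and bd: "\<And>f. f \<in> hol_funs \<Omega> \<Longrightarrow> (\<And>w. w \<in> K \<Longrightarrow> cmod (f w) < e) \<Longrightarrow> cmod (T f z) < 1"
    using cont_lin_ops_eval_bound[OF open_dom T z] by blast
  have "compact (insert ?p K)" "insert ?p K \<subseteq> \<Omega>"
    using K p(1) by auto
  then obtain r where r: "0 \<le> r" "r < 1" "\<And>w. w \<in> insert ?p K \<Longrightarrow> cmod (h w) \<le> r"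
    using h_compact_bound by blast
  have fg: "(f \<circ> g) holomorphic_on ball 0 1"
    using g_dom by (intro holomorphic_on_compose_gen[OF g_hol hol_funs_holomorphic[OF f]]) auto
  \<comment> \<open>Approximating also at \<open>?p\<close> lets one polynomial serve for both functionals.\<close>
  have "cmod (T f z - f ?p) \<le> (1 + e) * \<eta>" if "\<eta> > 0" for \<eta>
  proof -
    obtain a :: "nat \<Rightarrow> complex" and n
      where approx: "\<And>w. w \<in> cball 0 r \<Longrightarrow> cmod ((f \<circ> g) w - (\<Sum>i<n. a i * w ^ i)) < e * \<eta>"
      using holomorphic_disc_polynomial_approx[OF fg r(1,2) mult_pos_pos[OF K(3) \<open>\<eta> > 0\<close>]] by blast
    define P where "P w = (\<Sum>i<n. a i * h w ^ i)" for w
    have P_hol: "P holomorphic_on \<Omega>"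
      unfolding P_def using hol_funs_holomorphic[OF h_hol] by (intro holomorphic_intros)
    have close: "cmod (f w - P w) < e * \<eta>" if "w \<in> insert ?p K" for w
    proof -
      have "w \<in> \<Omega>" using that p(1) K(2) by auto
      then show ?thesis
        using approx[of "h w"] r(3)[OF that] by (simp add: gh P_def)
    qed
    let ?d = "\<lambda>w. of_real (1 / \<eta>) * (f w - P w)"
    note lin = hol_functional_eval[OF T, of z]
    have d_hol: "?d holomorphic_on \<Omega>"
      using P_hol hol_funs_holomorphic[OF f] by (intro holomorphic_intros)
    have "cmod (T (zext \<Omega> ?d) z) < 1"
    proof (rule bd)
      show "zext \<Omega> ?d \<in> hol_funs \<Omega>" using d_hol by (rule zext_in_hol_funs)
      fix w assume w: "w \<in> K"
      then show "cmod (zext \<Omega> ?d w) < e"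
        using close[of w] K(2) \<open>\<eta> > 0\<close> by (auto simp: norm_divide field_simps)
    qed
    moreover have "T (zext \<Omega> ?d) z = of_real (1 / \<eta>) * (T f z - T (zext \<Omega> P) z)"
      using hol_functional_scale[OF lin, of "\<lambda>w. f w - P w" "of_real (1 / \<eta>)"]
        hol_functional_diff[OF lin _ P_hol] P_hol hol_funs_holomorphic[OF f]
      by (simp add: zext_hol_funs[OF f] holomorphic_on_diff)
    ultimately have 1: "cmod (T f z - T (zext \<Omega> P) z) < \<eta>"
      using \<open>\<eta> > 0\<close> by (simp add: norm_divide)
    have "T (zext \<Omega> P) z = (\<Sum>i<n. a i * T (zext \<Omega> (\<lambda>w. h w ^ i)) z)"
      unfolding P_def by (rule hol_functional_sum[OF lin]) (auto intro: h_powers_holomorphic)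
    then have "T (zext \<Omega> P) z = P ?p"
      by (simp add: spectral_operator_powers[OF T z spec] P_def p(2))
    then show ?thesis
      using 1 close[of ?p] norm_triangle_ineq[of "T f z - P ?p" "P ?p - f ?p"]
      by (simp add: norm_minus_commute algebra_simps)
  qed
  note bound = this
  have "cmod (T f z - f ?p) \<le> 0"
  proof (rule field_le_epsilon)
    fix \<epsilon> :: real assume "\<epsilon> > 0"
    then show "cmod (T f z - f ?p) \<le> 0 + \<epsilon>"
      using bound[of "\<epsilon> / (1 + e)"] K(3) by simp
  qed
  then show ?thesis by simp
qed

text \<open>If \<open>T\<close> is composition with \<open>\<phi>\<close>, this is \<open>h \<circ> \<phi> \<circ> g\<close>, the map \<open>\<phi>\<close> read in the chart.\<close>

definition disc_symbol :: "((complex \<Rightarrow> complex) \<Rightarrow> complex \<Rightarrow> complex) \<Rightarrow> complex \<Rightarrow> complex" where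
  "disc_symbol T w = T h (g w)"

lemma disc_symbol_holomorphic:
  assumes "T \<in> cont_lin_ops (hol_algebra \<Omega>)"
  shows "disc_symbol T holomorphic_on ball 0 1"
proof -
  have "(T h \<circ> g) holomorphic_on ball 0 1"
    using g_dom
    by (intro holomorphic_on_compose_gen[OF g_hol hol_funs_holomorphic[OF cont_lin_ops_range[OF assms h_hol]]]) auto
  then show ?thesis by (simp add: o_def disc_symbol_def[abs_def])
qed

text \<open>Surjectivity holds because \<open>T h\<close> has the same range as \<open>h\<close>. For injectivity, write \<open>h = T k\<close>; since
  \<open>T\<close> is composition with \<open>\<phi>\<close>, this reads \<open>h = k \<circ> \<phi>\<close>, which makes \<open>k \<circ> g\<close> a left inverse of the symbol.\<close>

lemma alg_aut_disc_symbol_bij: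
  assumes T: "T \<in> alg_aut (hol_algebra \<Omega>)"
  shows "bij_betw (disc_symbol T) (ball 0 1) (ball 0 1)"
proof -
  have lin: "T \<in> cont_lin_ops (hol_algebra \<Omega>)"
    using T by (simp add: alg_aut_def)
  have "g ` ball 0 1 = \<Omega>"
    using g_dom h_disc gh by (metis image_eqI image_subsetI subset_antisym subsetI)
  then have "disc_symbol T ` ball 0 1 = T h ` \<Omega>"
    unfolding disc_symbol_def[abs_def] by (metis image_image)
  then have img: "disc_symbol T ` ball 0 1 = ball 0 1"
    by (simp add: alg_aut_image[OF T h_hol] h_image)
  have rep: "T f z = f (g (T h z))" if "f \<in> hol_funs \<Omega>" "z \<in> \<Omega>" for f z
  proof (rule spectral_operator_eq[OF lin that(2) _ that(1)])
    show "T k z \<in> closure (k ` \<Omega>)" if "k \<in> hol_funs \<Omega>" for k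
      using alg_aut_image[OF T that] \<open>z \<in> \<Omega>\<close> closure_subset by blast
  qed
  obtain k where k: "k \<in> hol_funs \<Omega>" "T k = h"
    using T h_hol unfolding alg_aut_def topspace_hol_algebra
    by (metis (no_types, lifting) bij_betw_imp_surj_on imageE mem_Collect_eq)
  have "inj_on (disc_symbol T) (ball 0 1)"
  proof (rule inj_on_inverseI)
    fix w :: complex assume w: "w \<in> ball 0 1"
    show "(\<lambda>v. k (g v)) (disc_symbol T w) = w"
      using rep[OF k(1) g_dom[OF w]] hg[OF w] k(2) by (simp add: disc_symbol_def)
  qed
  with img show ?thesis by (simp add: bij_betw_def)
qed

end

section \<open>Isometries of the disc\<close>

text \<open>The left-hand side is the pseudo-hyperbolic distance of \<open>u 0\<close> and \<open>u w\<close>. After a Moebius map has moved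
  \<open>u 0\<close> back to \<open>0\<close>, the Schwarz lemma for the resulting automorphism gives one inequality, and for its
  inverse the other.\<close>

lemma disc_automorphism_Moebius_norm:
  assumes u: "u holomorphic_on ball 0 1" "bij_betw u (ball 0 1) (ball 0 1)" and w: "w \<in> ball 0 1"
  shows "cmod (Moebius_function 0 (u 0) (u w)) = cmod w"
proof -
  have img: "u ` ball 0 1 = ball 0 1" and inj: "inj_on u (ball 0 1)"
    using u(2) by (auto simp: bij_betw_def)
  obtain v where v: "v holomorphic_on ball 0 1" "\<And>z. z \<in> ball 0 1 \<Longrightarrow> v (u z) = z"
    using holomorphic_has_inverse[OF u(1) open_ball inj] img by metis
  have v_in: "v ` ball 0 1 \<subseteq> ball 0 1"
  proof
    fix y assume "y \<in> v ` ball 0 1"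
    then obtain z where "z \<in> ball 0 1" "y = v (u z)"
      using img by (metis (no_types, lifting) imageE)
    then show "y \<in> ball 0 1" using v(2) by simp
  qed
  let ?a = "u 0"
  have u_in: "\<And>z. cmod z < 1 \<Longrightarrow> cmod (u z) < 1"
    using img by auto
  have a: "cmod ?a < 1" using u_in[of 0] by simp
  define F where "F = Moebius_function 0 ?a \<circ> u"
  define G where "G = v \<circ> Moebius_function 0 (- ?a)"
  have F_hol: "F holomorphic_on ball 0 1"
    unfolding F_def using img by (intro holomorphic_on_compose_gen[OF u(1) Moebius_function_holomorphic[OF a]]) auto
  have G_hol: "G holomorphic_on ball 0 1"
    unfolding G_def
    using a by (intro holomorphic_on_compose_gen[OF Moebius_function_holomorphic v(1)])
      (auto intro!: Moebius_function_norm_lt_1)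
  have F0: "F 0 = 0"
    by (simp add: F_def Moebius_function_eq_zero)
  have F_in: "cmod (F z) < 1" if "cmod z < 1" for z
    using Moebius_function_norm_lt_1[OF a u_in[OF that]] by (simp add: F_def)
  have G_in: "cmod (G z) < 1" if "cmod z < 1" for z
    using Moebius_function_norm_lt_1[of "- ?a" z 0] a that v_in by (auto simp: G_def image_subset_iff)
  have GF: "G (F z) = z" if "cmod z < 1" for z
    using Moebius_function_compose[of "- ?a" ?a "u z"] a u_in[OF that] v(2) that
    by (simp add: F_def G_def)
  have G0: "G 0 = 0" using GF[of 0] F0 by simp
  have "cmod (F w) \<le> cmod w"
    using Schwarz_Lemma(1)[OF F_hol F0 F_in, of w] w by simp
  moreover have "cmod (G (F w)) \<le> cmod (F w)"
    using Schwarz_Lemma(1)[OF G_hol G0 G_in, of "F w"] F_in[of w] w by simp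
  ultimately show ?thesis
    using GF[of w] w by (simp add: F_def)
qed

text \<open>Moving \<open>u 0\<close> to \<open>0\<close> by a Moebius map produces equality in the Schwarz lemma, hence a rotation.\<close>

lemma disc_isometry_bij:
  assumes u: "u holomorphic_on ball 0 1" "u ` ball 0 1 \<subseteq> ball 0 1"
    and iso: "\<And>w. w \<in> ball 0 1 \<Longrightarrow> cmod (Moebius_function 0 (u 0) (u w)) = cmod w"
  shows "bij_betw u (ball 0 1) (ball 0 1)"
proof -
  let ?a = "u 0"
  have u_in: "\<And>z. cmod z < 1 \<Longrightarrow> cmod (u z) < 1"
    using u(2) by (simp add: image_subset_iff)
  have a: "cmod ?a < 1" using u_in[of 0] by simp
  define F where "F = Moebius_function 0 ?a \<circ> u"
  have F_hol: "F holomorphic_on ball 0 1"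
    unfolding F_def by (intro holomorphic_on_compose_gen[OF u(1) Moebius_function_holomorphic[OF a] u(2)])
  have F_norm: "cmod (F z) = cmod z" if "cmod z < 1" for z
    using iso[of z] that by (simp add: F_def)
  have "\<exists>\<alpha>. (\<forall>z. cmod z < 1 \<longrightarrow> F z = \<alpha> * z) \<and> cmod \<alpha> = 1"
  proof (rule Schwarz_Lemma(3)[OF F_hol _ _, of 0])
    show "F 0 = 0" using F_norm[of 0] by simp
    show "(\<exists>z. cmod z < 1 \<and> z \<noteq> 0 \<and> cmod (F z) = cmod z) \<or> cmod (deriv F 0) = 1"
      using F_norm[of "1/2"] by (intro disjI1 exI[of _ "1/2"]) auto
  qed (use F_norm in auto)
  then obtain \<alpha> where \<alpha>: "\<And>z. cmod z < 1 \<Longrightarrow> F z = \<alpha> * z" "cmod \<alpha> = 1" by blast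
  have \<alpha>0: "\<alpha> \<noteq> 0" using \<alpha>(2) by auto
  have inverse_F: "Moebius_function 0 (- ?a) (F z) = u z" if "cmod z < 1" for z
    using Moebius_function_compose[of "- ?a" ?a "u z"] a u_in[OF that] by (simp add: F_def)
  show ?thesis
  proof (rule bij_betw_byWitness[where f' = "\<lambda>y. Moebius_function 0 ?a y / \<alpha>"])
    show "\<forall>z\<in>ball 0 1. Moebius_function 0 ?a (u z) / \<alpha> = z"
      using \<alpha> \<alpha>0 by (auto simp: F_def)
    show "u ` ball 0 1 \<subseteq> ball 0 1" by (rule u(2))
    show range: "(\<lambda>y. Moebius_function 0 ?a y / \<alpha>) ` ball 0 1 \<subseteq> ball 0 1"
      using Moebius_function_norm_lt_1[OF a, of _ 0] \<alpha>(2) by (auto simp: norm_divide)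
    show "\<forall>y\<in>ball 0 1. u (Moebius_function 0 ?a y / \<alpha>) = y"
    proof
      fix y :: complex assume y: "y \<in> ball 0 1"
      let ?z = "Moebius_function 0 ?a y / \<alpha>"
      have z: "cmod ?z < 1" using range y by (simp add: image_subset_iff)
      then have "u ?z = Moebius_function 0 (- ?a) (Moebius_function 0 ?a y)"
        using inverse_F[OF z] \<alpha>(1)[OF z] \<alpha>0 by simp
      then show "u ?z = y"
        using Moebius_function_compose[of "- ?a" ?a y] a y by simp
    qed
  qed
qed

section \<open>Topological reflexivity\<close>

lemma ref_to_approx:
  assumes "open \<Omega>" and T: "T \<in> ref_to (hol_algebra \<Omega>) S" and f: "f \<in> hol_funs \<Omega>"
    and K: "compact K" "K \<subseteq> \<Omega>" and "0 < e"
  obtains L where "L \<in> S" "\<And>z. z \<in> K \<Longrightarrow> dist (L f z) (T f z) < e"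
proof -
  have cl: "T f \<in> hol_algebra \<Omega> closure_of {L f |L. L \<in> S}"
    using T f by (simp add: ref_to_def topspace_hol_algebra)
  then have "T f \<in> hol_funs \<Omega>"
    by (simp add: in_closure_of topspace_hol_algebra)
  then obtain U where "hol_open \<Omega> U" "T f \<in> U" "\<And>g z. g \<in> U \<Longrightarrow> z \<in> K \<Longrightarrow> dist (g z) (T f z) < e"
    using hol_open_basic[OF assms(1) K \<open>0 < e\<close>] by blast
  then show thesis
    using cl that unfolding in_closure_of openin_hol_algebra by blast
qed

lemma ref_to_alg_aut_closure:
  assumes "open \<Omega>" and T: "T \<in> ref_to (hol_algebra \<Omega>) (alg_aut (hol_algebra \<Omega>))"
    and f: "f \<in> hol_funs \<Omega>" and z: "z \<in> \<Omega>"
  shows "T f z \<in> closure (f ` \<Omega>)"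
  unfolding closure_approachable
proof (intro allI impI)
  fix e :: real assume "0 < e"
  then obtain L where L: "L \<in> alg_aut (hol_algebra \<Omega>)" "dist (L f z) (T f z) < e"
    using ref_to_approx[OF assms(1) T f, of "{z}" e] z by auto
  then show "\<exists>y\<in>f ` \<Omega>. dist y (T f z) < e"
    using alg_aut_image[OF L(1) f] z by blast
qed

text \<open>The values of \<open>T h\<close> at the two points \<open>g 0\<close> and \<open>g w\<close> are limits of those of \<open>L h\<close> for automorphisms
  \<open>L\<close>, for which the identity is known. The limit values lie in the open disc, where the pseudo-hyperbolic
  distance is continuous.\<close>

lemma (in disc_chart) ref_to_disc_symbol_isometry:
  assumes T: "T \<in> ref_to (hol_algebra \<Omega>) (alg_aut (hol_algebra \<Omega>))"
    and disc: "\<And>z. z \<in> \<Omega> \<Longrightarrow> T h z \<in> ball 0 1" and w: "w \<in> ball 0 1"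
  shows "cmod (Moebius_function 0 (disc_symbol T 0) (disc_symbol T w)) = cmod w"
proof -
  let ?a = "disc_symbol T 0" and ?b = "disc_symbol T w"
  have zero: "(0::complex) \<in> ball 0 1" by simp
  have "\<exists>L\<in>alg_aut (hol_algebra \<Omega>). dist (disc_symbol L 0) ?a < 1 / real (Suc n)
      \<and> dist (disc_symbol L w) ?b < 1 / real (Suc n)" for n
  proof -
    have K: "compact {g 0, g w}" "{g 0, g w} \<subseteq> \<Omega>" "0 < 1 / real (Suc n)"
      using g_dom[OF zero] g_dom[OF w] by auto
    obtain L where "L \<in> alg_aut (hol_algebra \<Omega>)"
      "\<And>z. z \<in> {g 0, g w} \<Longrightarrow> dist (L h z) (T h z) < 1 / real (Suc n)"
      using ref_to_approx[OF open_dom T h_hol K] by blast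
    then show ?thesis by (auto simp: disc_symbol_def)
  qed
  then obtain L where L: "\<And>n. L n \<in> alg_aut (hol_algebra \<Omega>)"
      "\<And>n. dist (disc_symbol (L n) 0) ?a < 1 / real (Suc n)"
      "\<And>n. dist (disc_symbol (L n) w) ?b < 1 / real (Suc n)"
    by metis
  have lim: "X \<longlonglongrightarrow> l" if "\<And>n. dist (X n) l < 1 / real (Suc n)" for X :: "nat \<Rightarrow> complex" and l
  proof (rule tendstoI)
    fix e :: real assume "0 < e"
    have "\<forall>\<^sub>F n in sequentially. 1 / real (Suc n) < e"
      using order_tendstoD(2)[OF LIMSEQ_inverse_real_of_nat \<open>0 < e\<close>] by (simp add: inverse_eq_divide)
    then show "\<forall>\<^sub>F n in sequentially. dist (X n) l < e"
      by eventually_elim (use that in \<open>auto intro: less_trans\<close>)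
  qed
  have ab: "cmod ?a < 1" "cmod ?b < 1"
    using disc g_dom[OF zero] g_dom[OF w] by (auto simp: disc_symbol_def)
  have "cmod (cnj ?a * ?b) < 1"
    using norm_mult_less[of "cnj ?a" 1 ?b 1] ab by simp
  then have nz: "1 - cnj ?a * ?b \<noteq> 0"
    by auto
  have "(\<lambda>n. cmod (Moebius_function 0 (disc_symbol (L n) 0) (disc_symbol (L n) w)))
      \<longlonglongrightarrow> cmod (Moebius_function 0 ?a ?b)"
    unfolding Moebius_function_simple
    by (intro tendsto_intros lim L nz)
  moreover have "cmod (Moebius_function 0 (disc_symbol (L n) 0) (disc_symbol (L n) w)) = cmod w" for n
    using L(1)[of n] disc_automorphism_Moebius_norm[OF disc_symbol_holomorphic alg_aut_disc_symbol_bij w]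
    by (simp add: alg_aut_def)
  ultimately show ?thesis
    by (simp add: LIMSEQ_const_iff)
qed

lemma (in disc_chart) ref_to_alg_aut_subset:
  "ref_to (hol_algebra \<Omega>) (alg_aut (hol_algebra \<Omega>)) \<subseteq> alg_aut (hol_algebra \<Omega>)"
proof
  fix T assume T: "T \<in> ref_to (hol_algebra \<Omega>) (alg_aut (hol_algebra \<Omega>))"
  then have lin: "T \<in> cont_lin_ops (hol_algebra \<Omega>)"
    by (simp add: ref_to_def)
  note spec = ref_to_alg_aut_closure[OF open_dom T]
  have disc: "T h z \<in> ball 0 1" if "z \<in> \<Omega>" for z
    using spectral_operator_disc[OF lin that spec[OF _ that]] .
  define \<phi> where "\<phi> = g \<circ> T h"
  have u_bij: "bij_betw (disc_symbol T) (ball 0 1) (ball 0 1)"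
  proof (rule disc_isometry_bij[OF disc_symbol_holomorphic[OF lin]])
    show "disc_symbol T ` ball 0 1 \<subseteq> ball 0 1"
      using disc g_dom by (auto simp: disc_symbol_def)
  qed (rule ref_to_disc_symbol_isometry[OF T disc])
  have h_bij: "bij_betw h \<Omega> (ball 0 1)"
    using h_image gh by (auto simp: bij_betw_def intro: inj_on_inverseI)
  have g_bij: "bij_betw g (ball 0 1) \<Omega>"
    by (rule bij_betw_byWitness[where f' = h]) (use gh hg g_dom h_disc in auto)
  have "bij_betw (g \<circ> (disc_symbol T \<circ> h)) \<Omega> \<Omega>"
    by (intro bij_betw_trans[OF bij_betw_trans[OF h_bij u_bij] g_bij])
  moreover have "(g \<circ> (disc_symbol T \<circ> h)) z = \<phi> z" if "z \<in> \<Omega>" for z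
    using gh[OF that] by (simp add: \<phi>_def disc_symbol_def)
  ultimately have "bij_betw \<phi> \<Omega> \<Omega>"
    by (simp cong: bij_betw_cong)
  moreover have "\<phi> holomorphic_on \<Omega>"
    unfolding \<phi>_def using disc
    by (intro holomorphic_on_compose_gen[OF hol_funs_holomorphic[OF cont_lin_ops_range[OF lin h_hol]] g_hol]) auto
  moreover have "T f = zext \<Omega> (f \<circ> \<phi>)" if f: "f \<in> hol_funs \<Omega>" for f
  proof
    fix z
    show "T f z = zext \<Omega> (f \<circ> \<phi>) z"
    proof (cases "z \<in> \<Omega>")
      case True
      then show ?thesis
        using spectral_operator_eq[OF lin True spec[OF _ True] f] by (simp add: \<phi>_def)
    next
      case False
      then show ?thesis
        using hol_funs_outside[OF cont_lin_ops_range[OF lin f]] by simp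
    qed
  qed
  ultimately show "T \<in> alg_aut (hol_algebra \<Omega>)"
    using composition_in_alg_aut[OF open_dom lin] by blast
qed

lemma alg_aut_subset_ref_to:
  "alg_aut (hol_algebra \<Omega>) \<subseteq> ref_to (hol_algebra \<Omega>) (alg_aut (hol_algebra \<Omega>))"
proof
  fix T assume T: "T \<in> alg_aut (hol_algebra \<Omega>)"
  then have lin: "T \<in> cont_lin_ops (hol_algebra \<Omega>)"
    by (simp add: alg_aut_def)
  show "T \<in> ref_to (hol_algebra \<Omega>) (alg_aut (hol_algebra \<Omega>))"
    unfolding ref_to_def in_closure_of topspace_hol_algebra
    using T lin cont_lin_ops_range[OF lin] by blast
qed

text \<open>In the proof, \<open>C c\<close> is composition with multiplication by \<open>c\<close>: an automorphism if \<open>c \<noteq> 0\<close>, and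
  evaluation at \<open>0\<close> if \<open>c = 0\<close>, which is the limit of the former. It cannot be an automorphism, since it
  shrinks the range of the identity function to a point.\<close>

lemma not_reflexive_plane:
  "\<not> topologically_reflexive (hol_algebra UNIV) (alg_aut (hol_algebra UNIV))"
proof
  let ?A = "hol_algebra UNIV"
  define C where "C c = restrict (\<lambda>f. zext UNIV (f \<circ> (\<lambda>z. c * z))) (hol_funs UNIV)" for c :: complex
  have lin: "C c \<in> cont_lin_ops ?A" for c
    unfolding C_def by (rule composition_in_cont_lin_ops) (auto intro!: holomorphic_intros)
  have aut: "C c \<in> alg_aut ?A" if "c \<noteq> 0" for c
  proof (rule composition_in_alg_aut[OF open_UNIV lin])
    show "(\<lambda>z. c * z) holomorphic_on UNIV" by (intro holomorphic_intros)
    show "bij_betw (\<lambda>z. c * z) UNIV UNIV"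
      by (rule bij_betw_byWitness[where f' = "\<lambda>z. z / c"]) (use that in auto)
  qed (simp add: C_def)
  assume "topologically_reflexive ?A (alg_aut ?A)"
  moreover have "C 0 \<in> ref_to ?A (alg_aut ?A)"
  proof -
    have "C 0 f \<in> ?A closure_of {L f |L. L \<in> alg_aut ?A}" if f: "f \<in> hol_funs UNIV" for f
      unfolding in_closure_of topspace_hol_algebra openin_hol_algebra
    proof (intro conjI allI impI)
      show "C 0 f \<in> hol_funs UNIV" by (rule cont_lin_ops_range[OF lin f])
      fix U assume "C 0 f \<in> U \<and> hol_open UNIV U"
      then obtain K e where K: "compact K" "0 < e"
          "{g \<in> hol_funs UNIV. \<forall>z\<in>K. dist (g z) (C 0 f z) < e} \<subseteq> U"
        unfolding hol_open_def by meson
      have "isCont f 0"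
        using hol_funs_holomorphic[OF f]
        by (metis UNIV_I continuous_on_eq_continuous_at holomorphic_on_imp_continuous_on open_UNIV)
      then obtain d where d: "d > 0" "\<And>z. cmod z < d \<Longrightarrow> dist (f z) (f 0) < e"
        using \<open>0 < e\<close> by (auto simp: continuous_at_eps_delta dist_norm)
      obtain B where B: "B > 0" "\<And>z. z \<in> K \<Longrightarrow> cmod z \<le> B"
        using compact_imp_bounded[OF K(1)] by (auto simp: bounded_pos)
      define c where "c = complex_of_real (d / (2 * B))"
      have "c \<noteq> 0" using d(1) B(1) by (simp add: c_def)
      have "cmod (c * z) < d" if "z \<in> K" for z
      proof -
        have "cmod (c * z) = d / (2 * B) * cmod z"
          using d(1) B(1) by (simp add: c_def norm_mult norm_divide)
        also have "\<dots> \<le> d / (2 * B) * B"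
          using B d(1) that by (intro mult_left_mono) auto
        also have "\<dots> < d" using d(1) B(1) by simp
        finally show ?thesis .
      qed
      then have "\<forall>z\<in>K. dist (C c f z) (C 0 f z) < e"
        using d(2) f by (simp add: C_def)
      then have "C c f \<in> U"
        using K(3) cont_lin_ops_range[OF lin f] by blast
      then show "\<exists>y. y \<in> {L f |L. L \<in> alg_aut ?A} \<and> y \<in> U"
        using aut[OF \<open>c \<noteq> 0\<close>] by blast
    qed
    then show ?thesis
      using lin by (simp add: ref_to_def topspace_hol_algebra)
  qed
  ultimately have "C 0 \<in> alg_aut ?A"
    by (simp add: topologically_reflexive_def)
  moreover have id: "(\<lambda>z. z) \<in> hol_funs UNIV"
    by (simp add: hol_funs_def)
  ultimately have "C 0 (\<lambda>z. z) ` UNIV = UNIV"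
    using alg_aut_image[of "C 0" UNIV "\<lambda>z. z"] by simp
  then have "(1::complex) \<in> C 0 (\<lambda>z. z) ` UNIV" by simp
  then show False
    using id by (auto simp: C_def)
qed

theorem theorem8:
  fixes \<Omega> :: "complex set"
  assumes "open \<Omega>" and "connected \<Omega>" and "\<Omega> \<noteq> {}" and "simply_connected \<Omega>"
  shows "topologically_reflexive (hol_algebra \<Omega>) (alg_aut (hol_algebra \<Omega>)) \<longleftrightarrow> \<Omega> \<noteq> UNIV"
proof
  assume "topologically_reflexive (hol_algebra \<Omega>) (alg_aut (hol_algebra \<Omega>))"
  then show "\<Omega> \<noteq> UNIV" using not_reflexive_plane by blast
next
  assume "\<Omega> \<noteq> UNIV"
  then obtain h g where hol: "h holomorphic_on \<Omega>" "g holomorphic_on ball 0 1"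
      and hg: "\<forall>z\<in>\<Omega>. h z \<in> ball 0 1 \<and> g (h z) = z" "\<forall>z\<in>ball 0 1. g z \<in> \<Omega> \<and> h (g z) = z"
    using simply_connected_eq_biholomorphic_to_disc[OF assms(1)] assms(3,4) by blast
  interpret disc_chart \<Omega> "zext \<Omega> h" g
    by unfold_locales (use assms(1,3) hol hg in auto)
  show "topologically_reflexive (hol_algebra \<Omega>) (alg_aut (hol_algebra \<Omega>))"
    unfolding topologically_reflexive_def
    using ref_to_alg_aut_subset alg_aut_subset_ref_to by blast
qed

end
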